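(* Let $\mathbf{t}_3$ be the ternary Thue--Morse word, the fixed point starting with $0$ of the morphism $0\mapsto012$, $1\mapsto120$, $2\mapsto201$. Then its additive complexity is the sequence $135^\omega$, i.e., $\rho^{\mathrm{add}}_{\mathbf{t}_3}(0)=1$, $\rho^{\mathrm{add}}_{\mathbf{t}_3}(1)=3$, and $\rho^{\mathrm{add}}_{\mathbf{t}_3}(n)=5$ for all $n\ge2$.
   Context: Letters $0,1,2$ are regarded as integers. Words $u,v$ are additively equivalent if $|u|=|v|$ and $|u|_1+2|u|_2=|v|_1+2|v|_2$ ($|w|_a$ counts occurrences of $a$); $\rho^{\mathrm{add}}_{\mathbf{x}}(n)$ is the number of additive equivalence classes of length-$n$ factors of $\mathbf{x}$. *)

theory Defs
  imports Main "HOL-Library.Stream"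
begin

text \<open>
  Finite words are lists and infinite words are streams, over the letters 0, 1, 2
  regarded as integers.
\<close>

definition alphabet :: "int set" where
  "alphabet = {0, 1, 2}"

definition additively_equivalent :: "int list \<Rightarrow> int list \<Rightarrow> bool" where
  "additively_equivalent u v \<longleftrightarrow>
     length u = length v \<and>
     count_list u 1 + 2 * count_list u 2 = count_list v 1 + 2 * count_list v 2"

definition additive_equivalence :: "int list rel" where
  "additive_equivalence =
     {(u, v). u \<in> lists alphabet \<and> v \<in> lists alphabet \<and> additively_equivalent u v}"

lemma equiv_additive_equivalence: "equiv (lists alphabet) additive_equivalence"
  by (rule equivI)
     (auto simp: additive_equivalence_def additively_equivalent_def refl_on_def sym_def trans_def)

definition factors_of_length :: "'a stream \<Rightarrow> nat \<Rightarrow> 'a list set" where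
  "factors_of_length x n = {stake n (sdrop i x) | i. True}"

definition additive_complexity :: "int stream \<Rightarrow> nat \<Rightarrow> nat" where
  "additive_complexity x n = card (factors_of_length x n // additive_equivalence)"

text \<open>
  The morphism is given by its images of letters; its value outside the alphabet is irrelevant.
\<close>

definition tm3_morphism :: "int \<Rightarrow> int list" where
  "tm3_morphism a =
     (if a = 0 then [0, 1, 2] else if a = 1 then [1, 2, 0] else if a = 2 then [2, 0, 1] else [a])"

text \<open>
  A morphism without empty letter images acts on an infinite word by concatenating the images
  of its letters.
\<close>

definition morphism_image :: "('a \<Rightarrow> 'b list) \<Rightarrow> 'a stream \<Rightarrow> 'b stream" where
  "morphism_image f x = flat (smap f x)"

definition t3 :: "int stream" where
  "t3 = (THE x. x \<in> streams alphabet \<and> morphism_image tm3_morphism x = x \<and> shd x = 0)"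

text \<open>The definite description is legitimate:\<close>

lemma morphism_image_snth:
  assumes "x \<in> streams alphabet" and "k < 3"
  shows "morphism_image tm3_morphism x !! (3 * n + k) = tm3_morphism (x !! n) ! k"
  using assms
proof (induction n arbitrary: x)
  case 0
  have "shd x \<in> alphabet" using 0 by (metis streams_shd)
  then have "tm3_morphism (shd x) \<noteq> []" "length (tm3_morphism (shd x)) = 3"
    by (auto simp: tm3_morphism_def alphabet_def)
  then show ?case using 0
    by (cases x) (simp add: morphism_image_def flat_Stream shift_snth_less)
next
  case (Suc n)
  have "shd x \<in> alphabet" using Suc.prems by (metis streams_shd)
  then have ne: "tm3_morphism (shd x) \<noteq> []" and len: "length (tm3_morphism (shd x)) = 3"
    by (auto simp: tm3_morphism_def alphabet_def)
  have "morphism_image tm3_morphism x = tm3_morphism (shd x) @- morphism_image tm3_morphism (stl x)"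
    using ne by (cases x) (simp add: morphism_image_def flat_Stream)
  then have "morphism_image tm3_morphism x !! (3 * Suc n + k)
      = morphism_image tm3_morphism (stl x) !! (3 * n + k)"
    using len by (simp add: shift_snth_ge del: snth.simps)
  also have "\<dots> = tm3_morphism (stl x !! n) ! k"
    using Suc.IH[of "stl x"] Suc.prems by (metis streams_stl)
  finally show ?case by simp
qed

lemma fixed_point_iff:
  assumes "x \<in> streams alphabet"
  shows "morphism_image tm3_morphism x = x \<longleftrightarrow>
         (\<forall>n. \<forall>k<3. x !! (3 * n + k) = tm3_morphism (x !! n) ! k)" (is "?L \<longleftrightarrow> ?R")
proof
  assume ?L
  then show ?R using morphism_image_snth[OF assms] by metis
next
  assume R: ?R
  have "morphism_image tm3_morphism x !! m = x !! m" for m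
  proof -
    have "m mod 3 < 3" by simp
    with R morphism_image_snth[OF assms this, of "m div 3"]
    have "morphism_image tm3_morphism x !! (3 * (m div 3) + m mod 3) = x !! (3 * (m div 3) + m mod 3)"
      by metis
    then show ?thesis by simp
  qed
  then show ?L by (metis smap_alt stream.map_id)
qed

fun digit_sum3 :: "nat \<Rightarrow> nat" where
  "digit_sum3 n = (if n = 0 then 0 else digit_sum3 (n div 3) + n mod 3)"

declare digit_sum3.simps [simp del]

lemma digit_sum3_add: "k < 3 \<Longrightarrow> digit_sum3 (3 * n + k) = digit_sum3 n + k"
  by (cases "3 * n + k = 0") (auto simp: digit_sum3.simps[of "3 * n + k"])

lemma tm3_morphism_nth:
  assumes "k < 3"
  shows "tm3_morphism (int (s mod 3)) ! k = int ((s + k) mod 3)"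
proof -
  have "s mod 3 = 0 \<or> s mod 3 = 1 \<or> s mod 3 = 2" "k = 0 \<or> k = 1 \<or> k = 2"
    using assms by linarith+
  moreover have "(s + k) mod 3 = (s mod 3 + k) mod 3" by (simp add: mod_add_left_eq)
  ultimately show ?thesis by (auto simp: tm3_morphism_def numeral_2_eq_2)
qed

lemma ex1_t3:
  "\<exists>!x. x \<in> streams alphabet \<and> morphism_image tm3_morphism x = x \<and> shd x = 0"
proof (rule ex_ex1I)
  let ?x = "smap (\<lambda>n. int (digit_sum3 n mod 3)) nats"
  have nth: "?x !! n = int (digit_sum3 n mod 3)" for n by simp
  have "int (m mod 3) \<in> alphabet" for m :: nat
    unfolding alphabet_def by simp linarith
  then have mem: "?x \<in> streams alphabet"
    unfolding streams_iff_snth nth by (rule allI)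
  have "morphism_image tm3_morphism ?x = ?x"
    unfolding fixed_point_iff[OF mem] nth by (simp add: digit_sum3_add tm3_morphism_nth)
  moreover have "shd ?x = 0" by (simp add: digit_sum3.simps[of 0])
  ultimately show
    "\<exists>x. x \<in> streams alphabet \<and> morphism_image tm3_morphism x = x \<and> shd x = 0"
    using mem by blast
next
  fix x y
  assume x: "x \<in> streams alphabet \<and> morphism_image tm3_morphism x = x \<and> shd x = 0"
    and y: "y \<in> streams alphabet \<and> morphism_image tm3_morphism y = y \<and> shd y = 0"
  have "x !! m = y !! m" for m
  proof (induction m rule: less_induct)
    case (less m)
    show ?case
    proof (cases "m = 0")
      case True
      then show ?thesis using x y by simp
    next
      case False
      then have "x !! (m div 3) = y !! (m div 3)" using less by simp
      moreover have "m mod 3 < 3" by simp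
      ultimately have "x !! (3 * (m div 3) + m mod 3) = y !! (3 * (m div 3) + m mod 3)"
        using x y fixed_point_iff by metis
      then show ?thesis by simp
    qed
  qed
  then show "x = y" by (metis smap_alt stream.map_id)
qed

lemma t3_fixed_point:
  "t3 \<in> streams alphabet" "morphism_image tm3_morphism t3 = t3" "shd t3 = 0"
  using theI'[OF ex1_t3] unfolding t3_def by blast+

end

(* Put P(i) = (t_0 - 1) + ... + (t_{i-1} - 1). Every block 012, 120, 201 has sum 3, so P(3m) = 0, and
   P(3m+1), P(3m+2) are bijective functions of t_m with values in {-1,0,1}. The sum of the
   length-n factor at position i is n + P(i+n) - P(i), which leaves at most five values. All
   five occur for n >= 2 because any two letters occur in t at any given positive distance; choosing
   the residue of i mod 3 such that neither i nor i+n is divisible by 3 then yields every pair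
   (P(i), P(i+n)). *)
theory Submission
  imports Defs
begin

section \<open>Additive classes counted by letter sums\<close>

text \<open>The class of \<open>x\<close> is the fibre of \<open>f\<close> in \<open>B\<close> over
  \<open>f x\<close>, so classes and values correspond. A class may leave \<open>A\<close>, hence
  the larger set \<open>B\<close>.\<close>

lemma card_quotient_kernel:
  assumes "A \<subseteq> B" and R: "\<And>x y. (x, y) \<in> R \<longleftrightarrow> x \<in> B \<and> y \<in> B \<and> f x = f y"
  shows "card (A // R) = card (f ` A)"
proof -
  let ?g = "\<lambda>v. {y \<in> B. f y = v}"
  have "A // R = ?g ` f ` A"
  proof -
    have "R `` {x} = ?g (f x)" if "x \<in> A" for x
      using that assms by (auto simp: Image_def)
    then show ?thesis by (simp add: quotient_def image_image UNION_singleton_eq_range)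
  qed
  moreover have "inj_on ?g (f ` A)"
    using assms(1) by (force simp: inj_on_def)
  ultimately show ?thesis by (simp add: card_image)
qed

lemma sum_list_alphabet:
  "u \<in> lists alphabet \<Longrightarrow> sum_list u = int (count_list u 1 + 2 * count_list u 2)"
  by (induction u) (auto simp: alphabet_def)

lemma additive_complexity_eq_card_sums:
  assumes "x \<in> streams alphabet"
  shows "additive_complexity x n = card (range (\<lambda>i. sum_list (stake n (sdrop i x))))"
proof -
  let ?A = "factors_of_length x n" and ?B = "{u \<in> lists alphabet. length u = n}"
  have sub: "?A \<subseteq> ?B"
  proof
    fix u assume "u \<in> ?A"
    then obtain i where "u = stake n (sdrop i x)" by (auto simp: factors_of_length_def)
    moreover have "set (stake n (sdrop i x)) \<subseteq> alphabet"
      using assms by (auto simp: streams_iff_snth in_set_conv_nth sdrop_snth)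
    ultimately show "u \<in> ?B" by auto
  qed
  \<comment> \<open>Letter sums alone do not separate words of different lengths. Restricting to
    length \<open>n\<close> makes the relation the kernel of \<open>sum_list\<close> and keeps the
    classes of words in \<open>?A\<close>, as equivalent words have equal length.\<close>
  let ?R = "additive_equivalence \<inter> ?B \<times> ?B"
  have "?A // additive_equivalence = ?A // ?R"
  proof -
    have "additive_equivalence `` {u} = ?R `` {u}" if "u \<in> ?A" for u
      using that sub by (auto simp: additive_equivalence_def additively_equivalent_def)
    then show ?thesis by (simp add: quotient_def)
  qed
  also have "card \<dots> = card (sum_list ` ?A)"
  proof (rule card_quotient_kernel[OF sub])
    fix u v
    have "sum_list u = sum_list v \<longleftrightarrow>
        count_list u 1 + 2 * count_list u 2 = count_list v 1 + 2 * count_list v 2"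
      if "u \<in> lists alphabet" "v \<in> lists alphabet"
      using that by (simp only: sum_list_alphabet of_nat_eq_iff)
    then show "(u, v) \<in> ?R \<longleftrightarrow> u \<in> ?B \<and> v \<in> ?B \<and> sum_list u = sum_list v"
      by (auto simp: additive_equivalence_def additively_equivalent_def simp del: in_lists_conv_set)
  qed
  also have "sum_list ` ?A = range (\<lambda>i. sum_list (stake n (sdrop i x)))"
    by (auto simp: factors_of_length_def)
  finally show ?thesis by (simp add: additive_complexity_def)
qed

section \<open>Pairs of letters at a given distance\<close>

lemma t3_in_alphabet: "t3 !! m \<in> alphabet"
  using t3_fixed_point(1) by (simp add: streams_iff_snth)

lemma t3_cases: "t3 !! m = 0 \<or> t3 !! m = 1 \<or> t3 !! m = 2"
  using t3_in_alphabet[of m] by (simp add: alphabet_def)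

lemma t3_snth_block:
  "t3 !! (3 * m) = t3 !! m"
  "t3 !! (3 * m + 1) = (t3 !! m + 1) mod 3"
  "t3 !! (3 * m + 2) = (t3 !! m + 2) mod 3"
proof -
  have "t3 !! (3 * m + k) = tm3_morphism (t3 !! m) ! k" if "k < 3" for k
    using fixed_point_iff[OF t3_fixed_point(1)] t3_fixed_point(2) that by blast
  from this[of 0] this[of 1] this[of 2] t3_cases[of m]
  show "t3 !! (3 * m) = t3 !! m" "t3 !! (3 * m + 1) = (t3 !! m + 1) mod 3"
    "t3 !! (3 * m + 2) = (t3 !! m + 2) mod 3"
    by (auto simp: tm3_morphism_def)
qed

lemma t3_letter_occurs:
  assumes "a \<in> alphabet"
  shows "\<exists>m. t3 !! m = a"
proof -
  have "t3 !! 0 = 0" using t3_fixed_point(3) by simp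
  with t3_snth_block[of 0] have "t3 !! 0 = 0" "t3 !! 1 = 1" "t3 !! 2 = 2" by (simp_all add: numeral_2_eq_2 del: snth.simps)
  with assms show ?thesis unfolding alphabet_def by blast
qed

text \<open>Consider b - a mod 3. The first two letters of a block realise difference 1 for every a;
  each passage to a block boundary turns (a, b) into (a + 2, b) and so adds 1 to the difference. Two
  passages give differences 2 and 0.\<close>

lemma t3_adjacent_letters:
  assumes "a \<in> alphabet" "b \<in> alphabet"
  shows "\<exists>m. t3 !! m = a \<and> t3 !! (m + 1) = b"
proof -
  let ?Q = "\<lambda>a b. \<exists>m. t3 !! m = a \<and> t3 !! (m + 1) = b"
  have succ: "?Q a ((a + 1) mod 3)" if "a \<in> alphabet" for a
    using t3_letter_occurs[OF that] t3_snth_block by metis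
  \<comment> \<open>An adjacent pair straddling two blocks comes from an adjacent pair of block indices.\<close>
  have straddle: "?Q ((a + 2) mod 3) b" if "?Q a b" for a b
  proof -
    from that obtain m where m: "t3 !! m = a" "t3 !! (m + 1) = b" by blast
    have "3 * m + 2 + 1 = 3 * (m + 1)" by simp
    then have "t3 !! (3 * m + 2 + 1) = b" using t3_snth_block(1) m(2) by metis
    with m(1) t3_snth_block(3)[of m] show ?thesis by metis
  qed
  have 1: "?Q 0 1" "?Q 1 2" "?Q 2 0"
    using succ[of 0] succ[of 1] succ[of 2] by (simp_all add: alphabet_def)
  have 2: "?Q 2 1" "?Q 0 2" "?Q 1 0"
    using 1[THEN straddle] by simp_all
  have 3: "?Q 1 1" "?Q 2 2" "?Q 0 0"
    using 2[THEN straddle] by simp_all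
  from assms 1 2 3 show ?thesis unfolding alphabet_def by blast
qed

text \<open>Descent in base 3: for q = 3p + r, positions 3m and 3(m + p) + r carry the letters at m
  and m + p, the latter shifted by r mod 3. This needs p >= 1, so q = 1 and q = 2 are base
  cases.\<close>

lemma t3_letters_at_distance:
  assumes "q \<ge> 1" "a \<in> alphabet" "b \<in> alphabet"
  shows "\<exists>m. t3 !! m = a \<and> t3 !! (m + q) = b"
  using assms
proof (induction q arbitrary: a b rule: less_induct)
  case (less q)
  have shift: "\<exists>c \<in> alphabet. (c + int k) mod 3 = d" if "d \<in> alphabet" "k < 3" for d k
    using that by (intro bexI[of _ "(d - int k) mod 3"]) (auto simp: alphabet_def mod_simps)
  consider "q = 1" | "q = 2" | "q div 3 \<ge> 1" using less.prems(1) by linarith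
  then show ?case
  proof cases
    case 1
    then show ?thesis using t3_adjacent_letters less.prems by simp
  next
    case 2
    \<comment> \<open>Distance 2 leads from the middle of one block to the start of the next;
      \<open>c\<close> is the letter whose block has \<open>a\<close> in the middle.\<close>
    obtain c where c: "c \<in> alphabet" "(c + 1) mod 3 = a"
      using shift[of a 1] less.prems by auto
    then obtain m where m: "t3 !! m = c" "t3 !! (m + 1) = b"
      using t3_adjacent_letters less.prems by blast
    have "3 * m + 1 + q = 3 * (m + 1)" using 2 by simp
    then have "t3 !! (3 * m + 1 + q) = b" using t3_snth_block(1) m(2) by metis
    then show ?thesis using t3_snth_block(2)[of m] m(1) c(2) by metis
  next
    case 3
    define p r where "p = q div 3" and "r = q mod 3"
    then have q: "q = 3 * p + r" "r < 3" "p < q" "p \<ge> 1" using 3 by auto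
    obtain c where c: "c \<in> alphabet" "(c + int r) mod 3 = b"
      using shift[of b r] q less.prems by auto
    then obtain m where m: "t3 !! m = a" "t3 !! (m + p) = c"
      using less.IH[OF q(3,4)] less.prems by blast
    have "r = 0 \<or> r = 1 \<or> r = 2" using q by linarith
    then have "t3 !! (3 * (m + p) + r) = (c + int r) mod 3"
      using t3_snth_block[of "m + p"] m(2) t3_cases[of "m + p"] by auto
    then have "t3 !! (3 * m + q) = b" using c q by (simp add: algebra_simps)
    then show ?thesis using t3_snth_block(1)[of m] m(1) by metis
  qed
qed

section \<open>Centered prefix sums\<close>

definition centered_prefix_sum :: "nat \<Rightarrow> int" where
  "centered_prefix_sum i = sum_list (stake i t3) - int i"

lemma sum_factor_t3:
  "sum_list (stake n (sdrop i t3)) =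
    int n + centered_prefix_sum (i + n) - centered_prefix_sum i"
  by (simp add: centered_prefix_sum_def flip: stake_add)

lemma centered_prefix_sum_Suc:
  "centered_prefix_sum (Suc i) = centered_prefix_sum i + t3 !! i - 1"
  by (simp add: centered_prefix_sum_def stake_Suc del: stake.simps)

lemma centered_prefix_sum_block:
  "centered_prefix_sum (3 * m) = 0"
  "centered_prefix_sum (3 * m + 1) = t3 !! m - 1"
  "centered_prefix_sum (3 * m + 2) = (2 * t3 !! m) mod 3 - 1"
proof -
  have step:
    "centered_prefix_sum (3 * m + 1) = centered_prefix_sum (3 * m) + t3 !! m - 1"
    \<comment> \<open>The first two letters of the block of 0, 1, 2 sum to 1, 3, 2, which is one
      more than twice the letter mod 3.\<close>
    "centered_prefix_sum (3 * m + 2) = centered_prefix_sum (3 * m) + (2 * t3 !! m) mod 3 - 1"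
    "centered_prefix_sum (3 * Suc m) = centered_prefix_sum (3 * m)" for m
  proof -
    note S = centered_prefix_sum_Suc[of "3 * m"] centered_prefix_sum_Suc[of "3 * m + 1"]
      centered_prefix_sum_Suc[of "3 * m + 2"]
    have i: "Suc (3 * m) = 3 * m + 1" "Suc (3 * m + 1) = 3 * m + 2" "Suc (3 * m + 2) = 3 * Suc m"
      by simp_all
    show
      "centered_prefix_sum (3 * m + 1) = centered_prefix_sum (3 * m) + t3 !! m - 1"
      "centered_prefix_sum (3 * m + 2) = centered_prefix_sum (3 * m) + (2 * t3 !! m) mod 3 - 1"
      "centered_prefix_sum (3 * Suc m) = centered_prefix_sum (3 * m)"
      using S[unfolded i t3_snth_block] t3_cases[of m] by auto
  qed
  have "centered_prefix_sum (3 * m) = 0"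
  proof (induction m)
    case 0
    show ?case by (simp add: centered_prefix_sum_def)
  next
    case (Suc m)
    then show ?case by (simp only: step)
  qed
  with step[of m] show "centered_prefix_sum (3 * m) = 0"
    "centered_prefix_sum (3 * m + 1) = t3 !! m - 1"
    "centered_prefix_sum (3 * m + 2) = (2 * t3 !! m) mod 3 - 1" by simp_all
qed

lemma centered_prefix_sum_bounds: "centered_prefix_sum i \<in> {-1..1}"
proof -
  define m where "m = i div 3"
  have "i = 3 * m \<or> i = 3 * m + 1 \<or> i = 3 * m + 2" unfolding m_def by linarith
  then show ?thesis using centered_prefix_sum_block[of m] t3_cases[of m] by auto
qed

lemma centered_prefix_sum_pair:
  assumes "n \<ge> 2" "c \<in> {-1..1}" "d \<in> {-1..1}"
  shows "\<exists>i. centered_prefix_sum i = c \<and> centered_prefix_sum (i + n) = d"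
proof -
  \<comment> \<open>The block letter \<open>v + 1\<close> yields the value \<open>v\<close> at
    residue 1, and \<open>2 * (v + 1) mod 3\<close> yields it at residue 2, because doubling mod 3
    is its own inverse.\<close>
  have *: "v + 1 \<in> alphabet" "2 * (v + 1) mod 3 \<in> alphabet" "2 * (2 * (v + 1) mod 3) mod 3 = v + 1"
    if "v \<in> {-1..1}" for v :: int
  proof -
    from that have "v = -1 \<or> v = 0 \<or> v = 1" by auto
    then show "v + 1 \<in> alphabet" "2 * (v + 1) mod 3 \<in> alphabet"
      "2 * (2 * (v + 1) mod 3) mod 3 = v + 1" by (auto simp: alphabet_def)
  qed
  define q where "q = n div 3"
  consider "n = 3 * q" "q \<ge> 1" | "n = 3 * q + 1" "q \<ge> 1" | "n = 3 * q + 2"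
    unfolding q_def using assms(1) by linarith
  then show ?thesis
  proof cases
    case 1
    obtain m where "t3 !! m = c + 1" "t3 !! (m + q) = d + 1"
      using t3_letters_at_distance * 1 assms by metis
    moreover have "3 * m + 1 + n = 3 * (m + q) + 1" using 1 by simp
    ultimately show ?thesis
      by (intro exI[of _ "3 * m + 1"]) (simp only: centered_prefix_sum_block, simp)
  next
    case 2
    obtain m where "t3 !! m = c + 1" "t3 !! (m + q) = 2 * (d + 1) mod 3"
      using t3_letters_at_distance * 2 assms by metis
    moreover have "3 * m + 1 + n = 3 * (m + q) + 2" using 2 by simp
    ultimately show ?thesis using *(3)[OF assms(3)]
      by (intro exI[of _ "3 * m + 1"]) (simp only: centered_prefix_sum_block, simp)
  next
    case 3
    \<comment> \<open>A start at residue 1 would end at a multiple of 3, where the value is always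
      0. A start at residue 2 ends in block \<open>m + (q + 1)\<close>, a positive distance even for
      n = 2.\<close>
    obtain m where "t3 !! m = 2 * (c + 1) mod 3" "t3 !! (m + (q + 1)) = d + 1"
      using t3_letters_at_distance[of "q + 1"] * assms by (metis le_add2)
    moreover have "3 * m + 2 + n = 3 * (m + (q + 1)) + 1" using 3 by simp
    ultimately show ?thesis using *(3)[OF assms(2)]
      by (intro exI[of _ "3 * m + 2"]) (simp only: centered_prefix_sum_block, simp)
  qed
qed

lemma t3_factor_sums:
  assumes "n \<ge> 2"
  shows "range (\<lambda>i. sum_list (stake n (sdrop i t3))) = {int n - 2..int n + 2}"
proof
  have "\<bar>centered_prefix_sum (i + n) - centered_prefix_sum i\<bar> \<le> 2" for i
    using centered_prefix_sum_bounds[of i] centered_prefix_sum_bounds[of "i + n"] by auto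
  then have "sum_list (stake n (sdrop i t3)) \<in> {int n - 2..int n + 2}" for i
    unfolding sum_factor_t3 atLeastAtMost_iff by (smt (verit))
  then show "range (\<lambda>i. sum_list (stake n (sdrop i t3))) \<subseteq> {int n - 2..int n + 2}"
    by blast
next
  show "{int n - 2..int n + 2} \<subseteq> range (\<lambda>i. sum_list (stake n (sdrop i t3)))"
  proof
    fix s assume s: "s \<in> {int n - 2..int n + 2}"
    \<comment> \<open>The deviation \<open>s - int n\<close>, at most 2 in size, must be a
      difference of two values in {-1..1}. Clamping it gives the end value; what was cut off has
      size at most 1 and gives the start value.\<close>
    define d where "d = max (-1) (min 1 (s - int n))"
    have "d \<in> {-1..1}" "d - (s - int n) \<in> {-1..1}"
      using s by (auto simp: d_def)
    then obtain i where "centered_prefix_sum i = d - (s - int n)" "centered_prefix_sum (i + n) = d"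
      using centered_prefix_sum_pair[OF assms] by blast
    then have "sum_list (stake n (sdrop i t3)) = s" by (simp add: sum_factor_t3)
    then show "s \<in> range (\<lambda>i. sum_list (stake n (sdrop i t3)))" by blast
  qed
qed

theorem theorem4p4:
  shows "additive_complexity t3 0 = 1 \<and> additive_complexity t3 1 = 3 \<and>
    (\<forall>n\<ge>2. additive_complexity t3 n = 5)"
proof (intro conjI allI impI)
  note card_sums = additive_complexity_eq_card_sums[OF t3_fixed_point(1)]
  show "additive_complexity t3 0 = 1" by (simp add: card_sums)
  have "range (\<lambda>i. sum_list (stake 1 (sdrop i t3))) = range (\<lambda>i. t3 !! i)" by simp
  also have "\<dots> = alphabet" using t3_in_alphabet t3_letter_occurs by blast
  finally show "additive_complexity t3 1 = 3" by (simp add: card_sums alphabet_def)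
  show "additive_complexity t3 n = 5" if "n \<ge> 2" for n
    by (simp add: card_sums t3_factor_sums[OF that])
qed

end
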